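(* For every integer $n\ge0$, $\beta\in\mathbb{C}$ and $0\le p\le n$, with $G_n^{\beta}=U_nE^{n\beta}U_n^{-1}$, $$G_n^{\beta}x^p=\sum_{m=0}^{n}\binom{-n\beta+p}{m}\binom{n\beta+n-p}{n-m}x^m .$$
   Context: Polynomials over $\mathbb{C}$; $\binom{y}{k}=y(y-1)\cdots(y-k+1)/k!$ for $k\ge0$. $U_n$ is the linear map on polynomials of degree at most $n$ with $U_nx^p=\frac{(1-x)^{n+1}}{n!}\sum_{m\ge0}m^px^m$ ($0^0=1$), inverse $U_n^{-1}x^p=(x)_p[x+1]_{n-p}$, $(y)_p=y(y-1)\cdots(y-p+1)$, $[y]_k=y(y+1)\cdots(y+k-1)$. $E^{\gamma}c(x)=c(x+\gamma)$. *)

theory Defs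
  imports "HOL-Computational_Algebra.Computational_Algebra"
begin

text \<open>The infinite sum is read as a formal power series; for \<open>p \<le> n\<close> the product
  below is a polynomial, see \<open>fps_of_poly_U_monom\<close>.\<close>

definition U_series :: "nat \<Rightarrow> nat \<Rightarrow> complex fps" where
  "U_series n p =
     fps_const (1 / fact n) * (1 - fps_X) ^ (n + 1) * Abs_fps (\<lambda>m. of_nat m ^ p)"

definition U_monom :: "nat \<Rightarrow> nat \<Rightarrow> complex poly" where
  "U_monom n p = (THE q. fps_of_poly q = U_series n p)"

definition U_map :: "nat \<Rightarrow> complex poly \<Rightarrow> complex poly" where
  "U_map n c = (\<Sum>p\<le>n. smult (coeff c p) (U_monom n p))"

text \<open>Only meaningful on the image under \<open>U_map n\<close> of the polynomials of degree at most \<open>n\<close>,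
  on which \<open>U_map n\<close> is injective; see \<open>inj_on_U_map\<close> and \<open>U_inv_monom\<close>.\<close>

definition U_inv :: "nat \<Rightarrow> complex poly \<Rightarrow> complex poly" where
  "U_inv n = inv_into {c. degree c \<le> n} (U_map n)"

definition shift :: "complex \<Rightarrow> complex poly \<Rightarrow> complex poly" where
  "shift \<gamma> c = pcompose c [:\<gamma>, 1:]"

definition G_map :: "nat \<Rightarrow> complex \<Rightarrow> complex poly \<Rightarrow> complex poly" where
  "G_map n \<beta> = U_map n \<circ> shift (of_nat n * \<beta>) \<circ> U_inv n"

lemma poly_eq_sum_atMost:
  fixes c :: "complex poly"
  assumes "degree c \<le> n"
  shows "poly c x = (\<Sum>p\<le>n. coeff c p * x ^ p)"
  unfolding poly_altdef using assms
  by (intro sum.mono_neutral_left) (auto simp: coeff_eq_0)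

lemma ex_poly_series:
  "\<exists>q. fps_of_poly q = (1 - fps_X) ^ (p + 1) * Abs_fps (\<lambda>m. of_nat m ^ p :: complex)"
proof (induction p)
  case 0
  have "(1 - fps_X) * Abs_fps (\<lambda>m. 1 :: complex) = 1"
    by (rule fps_ext) (auto simp: left_diff_distrib)
  then show ?case by (intro exI[of _ 1]) simp
next
  case (Suc p)
  let ?F = "Abs_fps (\<lambda>m. of_nat m ^ p :: complex)"
  from Suc obtain q where q: "fps_of_poly q = (1 - fps_X) ^ (p + 1) * ?F" by blast
  have F: "Abs_fps (\<lambda>m. of_nat m ^ Suc p :: complex) = fps_X * fps_deriv ?F"
    by (rule fps_ext) (auto simp: fps_X_mult_nth)
  have d: "fps_of_poly (pderiv q) = (1 - fps_X) ^ (p + 1) * fps_deriv ?F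
      - of_nat (p + 1) * (1 - fps_X) ^ p * ?F"
  proof -
    have "fps_deriv ((1 - fps_X :: complex fps) ^ (p + 1)) = - (of_nat (p + 1) * (1 - fps_X) ^ p)"
      by (subst fps_deriv_power') (simp add: algebra_simps)
    then show ?thesis
      unfolding fps_of_poly_pderiv q fps_deriv_mult
      by (simp only: mult_minus_left diff_conv_add_uminus)
  qed
  have "fps_of_poly ([:0,1:] * ([:1,-1:] * pderiv q + smult (of_nat (p + 1)) q)) =
      fps_X * ((1 - fps_X) * fps_of_poly (pderiv q) + of_nat (p + 1) * fps_of_poly q)"
    by (simp only: fps_of_poly_mult fps_of_poly_add fps_of_poly_smult fps_of_nat)
      (simp add: fps_of_poly_pCons)
  also have "\<dots> = (1 - fps_X) ^ (Suc p + 1) * (fps_X * fps_deriv ?F)"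
    unfolding d q by (simp add: algebra_simps)
  finally show ?case unfolding F by blast
qed

lemma fps_of_poly_U_monom:
  assumes "p \<le> n"
  shows "fps_of_poly (U_monom n p) = U_series n p"
proof -
  obtain q where q: "fps_of_poly q = (1 - fps_X) ^ (p + 1) * Abs_fps (\<lambda>m. of_nat m ^ p :: complex)"
    using ex_poly_series by blast
  have n: "n + 1 = (n - p) + (p + 1)" using assms by simp
  define r where "r = smult (1 / fact n) ([:1,-1:] ^ (n - p) * q)"
  have r: "fps_of_poly r = U_series n p"
    unfolding r_def U_series_def n power_add[of _ "n - p"]
      fps_of_poly_smult fps_of_poly_mult fps_of_poly_power q mult.assoc
    by (simp add: fps_of_poly_pCons)
  show ?thesis
    unfolding U_monom_def
    by (rule theI[of _ r]) (simp_all add: r flip: fps_of_poly_eq_iff)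
qed

lemma fps_of_poly_U_map:
  assumes "degree c \<le> n"
  shows "fps_of_poly (U_map n c) =
    fps_const (1 / fact n) * (1 - fps_X) ^ (n + 1) * Abs_fps (\<lambda>m. poly c (of_nat m))"
proof -
  have "Abs_fps (\<lambda>m. poly c (of_nat m)) =
      (\<Sum>p\<le>n. fps_const (coeff c p) * Abs_fps (\<lambda>m. of_nat m ^ p))"
    by (rule fps_ext) (simp add: fps_sum_nth poly_eq_sum_atMost[OF assms])
  then show ?thesis
    by (simp add: U_map_def fps_of_poly_sum fps_of_poly_smult fps_of_poly_U_monom U_series_def
        sum_distrib_left mult_ac)
qed

lemma inj_on_U_map: "inj_on (U_map n) {c. degree c \<le> n}"
proof (rule inj_onI)
  fix c d assume cd: "c \<in> {c. degree c \<le> n}" "d \<in> {c. degree c \<le> n}" "U_map n c = U_map n d"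
  have "(1 - fps_X :: complex fps) \<noteq> 0"
    by (auto dest: arg_cong[of _ _ "\<lambda>f. fps_nth f 0"])
  then have "Abs_fps (\<lambda>m. poly c (of_nat m)) = Abs_fps (\<lambda>m. poly d (of_nat m))"
    using fps_of_poly_U_map[of c n] fps_of_poly_U_map[of d n] cd by simp
  then have *: "poly c (of_nat m) = poly d (of_nat m)" for m
    by (metis fps_nth_Abs_fps)
  have "range (of_nat :: nat \<Rightarrow> complex) \<subseteq> {x. poly (c - d) x = 0}"
    using * by auto
  then have "infinite {x. poly (c - d) x = 0}"
    by (meson finite_subset infinite_UNIV_nat finite_imageD inj_of_nat)
  then show "c = d" using poly_roots_finite[of "c - d"] by auto
qed

definition U_preimage :: "nat \<Rightarrow> nat \<Rightarrow> complex poly" where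
  "U_preimage n p = (\<Prod>i<p. [:- of_nat i, 1:]) * pochhammer [:1, 1:] (n - p)"

lemma degree_U_preimage:
  assumes "p \<le> n"
  shows "degree (U_preimage n p) \<le> n"
proof -
  have "degree (pochhammer [:1, 1 :: complex:] k) \<le> k" for k
  proof (induction k)
    case (Suc k)
    have "degree ([:1, 1 :: complex:] + of_nat k) \<le> 1"
      by (simp add: of_nat_poly)
    with Suc degree_mult_le[of "pochhammer [:1, 1 :: complex:] k" "[:1, 1:] + of_nat k"]
    show ?case unfolding pochhammer_Suc by linarith
  qed simp
  then have "degree (pochhammer [:1, 1 :: complex:] (n - p)) \<le> n - p" .
  moreover have "degree (\<Prod>i<p. [:- of_nat i, 1 :: complex:]) \<le> p"
    using degree_prod_sum_le[of "{..<p}" "\<lambda>i. [:- of_nat i, 1 :: complex:]"] by simp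
  ultimately show ?thesis
    using assms degree_mult_le[of "\<Prod>i<p. [:- of_nat i, 1 :: complex:]" "pochhammer [:1, 1:] (n - p)"]
    unfolding U_preimage_def by linarith
qed

lemma poly_U_preimage:
  assumes "p \<le> n"
  shows "poly (U_preimage n p) (of_nat m) =
    (if m < p then 0 else fact n * of_nat ((m - p + n) choose n))"
proof -
  have poch: "poly (pochhammer [:1, 1:] k) x = pochhammer (x + 1) k" for k and x :: complex
    by (induction k) (simp_all add: pochhammer_Suc algebra_simps)
  show ?thesis
  proof (cases "m < p")
    case True
    then show ?thesis by (auto simp: U_preimage_def poly_prod)
  next
    case False
    then obtain d where d: "m = d + p" by (metis le_add_diff_inverse2 not_less)
    have fall: "(\<Prod>i<k. of_nat (e + k) - of_nat i) = pochhammer (of_nat e + 1 :: complex) k" for k e :: nat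
    proof (induction k arbitrary: e)
      case (Suc k)
      have "(\<Prod>i<Suc k. of_nat (e + Suc k) - of_nat i) =
          (\<Prod>i<k. of_nat (Suc e + k) - of_nat i) * (of_nat e + 1 :: complex)"
        by simp
      then show ?case unfolding Suc.IH pochhammer_rec by (simp add: add_ac mult_ac)
    qed simp
    have "poly (U_preimage n p) (of_nat m) =
        pochhammer (of_nat d + 1) p * pochhammer (of_nat d + 1 + of_nat p) (n - p)"
      using fall[of d p] by (simp add: U_preimage_def poly_prod poch d add_ac del: add_diff_eq) (simp add: add_diff_eq)
    also have "\<dots> = pochhammer (of_nat d + 1) n"
      using pochhammer_product[OF assms] by metis
    also have "\<dots> = fact n * (of_nat (d + n) gchoose n)"
      by (simp add: gbinomial_pochhammer')
    finally show ?thesis using d by (simp add: binomial_gbinomial)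
  qed
qed

lemma U_U_preimage:
  assumes "p \<le> n"
  shows "U_map n (U_preimage n p) = monom 1 p"
proof -
  have "(1 - fps_X) ^ (n + 1) * Abs_fps (\<lambda>k. of_nat ((k + n) choose n) :: complex) = 1"
  proof (induction n)
    case 0
    show ?case by (rule fps_ext) (auto simp: left_diff_distrib)
  next
    case (Suc n)
    have step: "(1 - fps_X) * Abs_fps (\<lambda>k. of_nat ((k + Suc n) choose Suc n) :: complex) =
        Abs_fps (\<lambda>k. of_nat ((k + n) choose n))"
    proof (rule fps_ext)
      fix k
      show "fps_nth ((1 - fps_X) * Abs_fps (\<lambda>k. of_nat ((k + Suc n) choose Suc n) :: complex)) k =
        fps_nth (Abs_fps (\<lambda>k. of_nat ((k + n) choose n))) k"
        by (cases k) (auto simp: left_diff_distrib)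
    qed
    have "(1 - fps_X) ^ (Suc n + 1) * Abs_fps (\<lambda>k. of_nat ((k + Suc n) choose Suc n) :: complex) =
        (1 - fps_X) ^ (n + 1) *
        ((1 - fps_X) * Abs_fps (\<lambda>k. of_nat ((k + Suc n) choose Suc n) :: complex))"
      by (simp only: add_Suc power_Suc2 mult.assoc)
    also have "\<dots> = 1"
      unfolding step by (rule Suc)
    finally show ?case .
  qed
  then have *: "(1 - fps_X) ^ (n + 1) * (fps_X ^ p * Abs_fps (\<lambda>k. of_nat ((k + n) choose n) :: complex))
      = fps_X ^ p"
    by (metis mult.left_commute mult.right_neutral)
  have "Abs_fps (\<lambda>m. poly (U_preimage n p) (of_nat m)) =
      fps_const (fact n) * (fps_X ^ p * Abs_fps (\<lambda>k. of_nat ((k + n) choose n)))"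
    by (rule fps_ext) (simp add: poly_U_preimage[OF assms] fps_X_power_mult_nth)
  then have "fps_of_poly (U_map n (U_preimage n p)) = (fps_const (1 / fact n) * fps_const (fact n)) *
      ((1 - fps_X) ^ (n + 1) * (fps_X ^ p * Abs_fps (\<lambda>k. of_nat ((k + n) choose n))))"
    unfolding fps_of_poly_U_map[OF degree_U_preimage[OF assms]] by (simp add: mult_ac)
  also have "\<dots> = fps_of_poly (monom 1 p)"
    unfolding * by (simp add: fps_of_poly_monom)
  finally show ?thesis by (simp add: fps_of_poly_eq_iff)
qed

lemma U_inv_monom:
  assumes "p \<le> n"
  shows "U_inv n (monom 1 p) =
    (\<Prod>i<p. [:- of_nat i, 1:]) * pochhammer [:1, 1:] (n - p)"
  unfolding U_inv_def U_preimage_def[symmetric]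
  using inj_on_U_map degree_U_preimage[OF assms] U_U_preimage[OF assms]
  by (auto intro: inv_into_f_eq)

end

theory Submission
  imports Defs
begin

text \<open>The polynomial \<open>U_inv n (monom 1 p)\<close> is \<open>n!\<close> times the binomial coefficient of \<open>x + n - p\<close>
  over \<open>n\<close>. By linearity of \<open>U_map n\<close>, the theorem is therefore the expansion of the shifted
  binomial coefficient of \<open>x + a\<close> over \<open>n\<close>, where \<open>a = n\<beta> + n - p\<close>, in terms of those of
  \<open>x + n - m\<close> over \<open>n\<close> for \<open>m \<le> n\<close>. Expanding both sides in the binomial coefficients of \<open>x\<close>
  reduces it to trinomial revision and Vandermonde's convolution.\<close>

lemma gbinomial_shift_expansion:
  fixes a x :: "'a :: field_char_0"
  shows "(\<Sum>m\<le>n. (of_nat n - a gchoose m) * (a gchoose (n - m)) * (x + of_nat (n - m) gchoose n))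
    = (x + a) gchoose n"
proof -
  \<comment> \<open>Vandermonde splits \<open>x + of_nat (n - m) gchoose n\<close> along
    \<open>x gchoose j\<close>; this compares the resulting coefficient of
    \<open>x gchoose j\<close> with the one in \<open>(x + a) gchoose n\<close>.\<close>
  have inner: "(\<Sum>m\<le>n. (of_nat n - a gchoose m) * (a gchoose (n - m)) * (of_nat (n - m) gchoose (n - j)))
      = a gchoose (n - j)" if j: "j \<le> n" for j
  proof -
    \<comment> \<open>For \<open>m > j\<close> the last factor vanishes because
      \<open>n - m < n - j\<close>; the remaining range gives \<open>n - j \<le> n - m\<close>, as
      trinomial revision requires.\<close>
    have "(\<Sum>m\<le>n. (of_nat n - a gchoose m) * (a gchoose (n - m)) * (of_nat (n - m) gchoose (n - j)))
       = (\<Sum>m\<le>j. (of_nat n - a gchoose m) * (a gchoose (n - m)) * (of_nat (n - m) gchoose (n - j)))"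
      using j by (intro sum.mono_neutral_right) (auto simp flip: binomial_gbinomial simp del: of_nat_diff)
    also have "\<dots> = (\<Sum>m\<le>j. (a gchoose (n - j)) *
        ((of_nat n - a gchoose m) * (a - of_nat (n - j) gchoose (j - m))))"
    proof (rule sum.cong)
      fix m assume "m \<in> {..j}"
      then have "n - j \<le> n - m" "n - m - (n - j) = j - m" using j by auto
      then show "(of_nat n - a gchoose m) * (a gchoose (n - m)) * (of_nat (n - m) gchoose (n - j)) =
          (a gchoose (n - j)) * ((of_nat n - a gchoose m) * (a - of_nat (n - j) gchoose (j - m)))"
        using gbinomial_trinomial_revision[of "n - j" "n - m" a] by (simp add: mult_ac)
    qed simp
    \<comment> \<open>After this convolution the upper arguments add up to \<open>of_nat j\<close>,
      so the second factor is \<open>j choose j\<close>, which is 1.\<close>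
    also have "\<dots> = (a gchoose (n - j)) * ((of_nat n - a + (a - of_nat (n - j))) gchoose j)"
      by (simp only: gbinomial_Vandermonde flip: atLeast0AtMost sum_distrib_left)
    also have "of_nat n - a + (a - of_nat (n - j)) = of_nat j"
      using j by (simp add: of_nat_diff)
    finally show ?thesis by (simp flip: binomial_gbinomial)
  qed
  have "(\<Sum>m\<le>n. (of_nat n - a gchoose m) * (a gchoose (n - m)) * (x + of_nat (n - m) gchoose n))
      = (\<Sum>m\<le>n. \<Sum>j\<le>n. (x gchoose j) *
          ((of_nat n - a gchoose m) * (a gchoose (n - m)) * (of_nat (n - m) gchoose (n - j))))"
    unfolding gbinomial_Vandermonde[symmetric, of x] atLeast0AtMost
    by (simp only: sum_distrib_left mult_ac)
  also have "\<dots> = (\<Sum>j\<le>n. (x gchoose j) * (\<Sum>m\<le>n.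
          (of_nat n - a gchoose m) * (a gchoose (n - m)) * (of_nat (n - m) gchoose (n - j))))"
    by (subst sum.swap) (simp only: sum_distrib_left)
  also have "\<dots> = (\<Sum>j\<le>n. (x gchoose j) * (a gchoose (n - j)))"
    by (simp add: inner del: of_nat_diff)
  also have "\<dots> = (x + a) gchoose n"
    by (simp only: gbinomial_Vandermonde flip: atLeast0AtMost)
  finally show ?thesis .
qed

text \<open>The falling and the rising product join into one run of \<open>n\<close> consecutive
  factors, from \<open>x - p + 1\<close> to \<open>x + n - p\<close>.\<close>

lemma poly_U_preimage_gbinomial:
  assumes "p \<le> n"
  shows "poly (U_preimage n p) x = fact n * ((x + of_nat (n - p)) gchoose n)"
proof -
  have poch: "poly (pochhammer [:1, 1:] k) x = pochhammer (x + 1) k" for k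
    by (induction k) (simp_all add: pochhammer_Suc algebra_simps)
  \<comment> \<open>Both sides are \<open>fact p * (x gchoose p)\<close>.\<close>
  have fall: "(\<Prod>i<p. x - of_nat i) = pochhammer (x - of_nat p + 1) p"
    using gbinomial_mult_fact[of p x]
    by (simp add: gbinomial_pochhammer' atLeast0LessThan)
  have "poly (U_preimage n p) x =
      pochhammer (x - of_nat p + 1) p * pochhammer (x - of_nat p + 1 + of_nat p) (n - p)"
    by (simp add: U_preimage_def poly_prod poch fall)
  also have "\<dots> = pochhammer (x - of_nat p + 1) n"
    using pochhammer_product[OF assms] by metis
  also have "\<dots> = fact n * ((x + of_nat (n - p)) gchoose n)"
    using assms by (simp add: gbinomial_pochhammer' of_nat_diff)
  finally show ?thesis .
qed

lemma U_map_sum_smult: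
  "U_map n (\<Sum>i\<in>A. smult (f i) (c i)) = (\<Sum>i\<in>A. smult (f i) (U_map n (c i)))"
proof -
  have "U_map n (\<Sum>i\<in>A. smult (f i) (c i)) =
      (\<Sum>p\<le>n. \<Sum>i\<in>A. smult (f i * coeff (c i) p) (U_monom n p))"
    by (simp add: U_map_def coeff_sum smult_sum)
  also have "\<dots> = (\<Sum>i\<in>A. smult (f i) (U_map n (c i)))"
    by (subst sum.swap, rule poly_eqI) (simp add: U_map_def coeff_sum sum_distrib_left mult.assoc)
  finally show ?thesis .
qed

text \<open>Since \<open>U_map n\<close> sends \<open>U_preimage n m\<close> to
  \<open>monom 1 m\<close>, these coefficients at \<gamma> = n\<beta> become those of the
  theorem.\<close>

lemma shift_U_preimage:
  assumes "p \<le> n"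
  shows "shift \<gamma> (U_preimage n p) =
    (\<Sum>m\<le>n. smult ((of_nat p - \<gamma> gchoose m) * (\<gamma> + of_nat n - of_nat p gchoose (n - m)))
      (U_preimage n m))"
proof -
  \<comment> \<open>Chosen so that the shifted polynomial takes the value
    \<open>fact n * ((x + a) gchoose n)\<close> at \<open>x\<close>.\<close>
  define a where "a = \<gamma> + of_nat n - of_nat p"
  have "poly (shift \<gamma> (U_preimage n p)) x =
      poly (\<Sum>m\<le>n. smult ((of_nat n - a gchoose m) * (a gchoose (n - m))) (U_preimage n m)) x" for x
  proof -
    have "poly (shift \<gamma> (U_preimage n p)) x = fact n * ((x + a) gchoose n)"
      using assms
      by (simp add: shift_def poly_pcompose poly_U_preimage_gbinomial a_def of_nat_diff algebra_simps)
    also have "\<dots> = (\<Sum>m\<le>n. (of_nat n - a gchoose m) * (a gchoose (n - m)) *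
        (fact n * (x + of_nat (n - m) gchoose n)))"
      unfolding gbinomial_shift_expansion[of n a x, symmetric]
      by (simp only: sum_distrib_left mult_ac)
    finally show ?thesis
      by (simp add: poly_sum poly_U_preimage_gbinomial)
  qed
  then have "shift \<gamma> (U_preimage n p) =
      (\<Sum>m\<le>n. smult ((of_nat n - a gchoose m) * (a gchoose (n - m))) (U_preimage n m))"
    by (simp add: poly_eq_poly_eq_iff[symmetric] fun_eq_iff)
  moreover have "of_nat n - a = of_nat p - \<gamma>" by (simp add: a_def)
  ultimately show ?thesis by (simp add: a_def)
qed

theorem theorem6p3:
  fixes n p :: nat and \<beta> :: complex
  assumes "p \<le> n"
  shows "G_map n \<beta> (monom 1 p) =
    (\<Sum>m\<le>n. monom (((- of_nat n * \<beta> + of_nat p) gchoose m) *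
                    ((of_nat n * \<beta> + of_nat n - of_nat p) gchoose (n - m))) m)"
proof -
  have "G_map n \<beta> (monom 1 p) = U_map n (shift (of_nat n * \<beta>) (U_preimage n p))"
    by (simp add: G_map_def U_inv_monom[OF assms] U_preimage_def)
  also have "\<dots> = (\<Sum>m\<le>n. smult ((of_nat p - of_nat n * \<beta> gchoose m) *
      (of_nat n * \<beta> + of_nat n - of_nat p gchoose (n - m))) (monom 1 m))"
    by (simp add: shift_U_preimage[OF assms] U_map_sum_smult U_U_preimage)
  finally show ?thesis by (simp add: smult_monom)
qed

end
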